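(* Let $a,b>0$. The transform $F_{a,b}$ from $\mathrm{Imm}(I,\mathbb{C})/\mathrm{Tra}$ to $C^\infty(I,\mathbb{C}^\ast)$, $F_{a,b}(c)=2b\,|c'|^{1/2}\left(\frac{c'}{|c'|}\right)^{\frac{a}{2b}}$, pulls back the $L^2$ metric $g^{L^2}$ on $C^\infty(I,\mathbb{C}^\ast)$ to the elastic metric $g^{a,b}$; that is, for every $c$ and all tangent vectors $h,k$ at $c$, $$g^{L^2}_{F_{a,b}(c)}\big(DF_{a,b}(c)(h),DF_{a,b}(c)(k)\big)=g^{a,b}_c(h,k).$$
   Context: $I=[0,1]$, $\mathbb{C}^\ast=\mathbb{C}\setminus\{0\}$, and $\mathbb{R}^2$ is identified with $\mathbb{C}$. $\mathrm{Imm}(I,\mathbb{C})=\{c\in C^\infty(I,\mathbb{C}) : c'(t)\neq 0 \text{ for all } t\in I\}$, and $\mathrm{Imm}(I,\mathbb{C})/\mathrm{Tra}$ (the quotient by translations) is identified with the set of $c\in \mathrm{Imm}(I,\mathbb{C})$ with $c(0)=0$. Tangent vectors are smooth functions $h:I\to\mathbb{C}$ (with $h(0)=0$ for the quotient by translations). Elastic metric: for $c\in\mathrm{Imm}(I,\mathbb{C})$ let $T=c'/|c'|$ be the unit tangent, $N=iT$ the unit normal, $D_s=\frac{1}{|c'(t)|}\frac{d}{dt}$ and $\mathrm{d}s=|c'(t)|\,\mathrm{d}t$. Then $$g^{a,b}_c(h,k)=\int_I a^2\langle D_sh,N\rangle\langle D_sk,N\rangle+b^2\langle D_sh,T\rangle\langle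 D_sk,T\rangle\,\mathrm{d}s,$$ where $\langle z,w\rangle=\mathrm{Re}(z\overline{w})$ is the Euclidean inner product. $L^2$ metric: $g^{L^2}_q(w,z)=\mathrm{Re}\int_I w\overline{z}\,\mathrm{d}t$ for $q\in C^\infty(I,\mathbb{C})$ and $w,z\in C^\infty(I,\mathbb{C})$, restricted to the open subset $C^\infty(I,\mathbb{C}^\ast)$. Meaning of $F_{a,b}$: all operations are pointwise. Writing $c'=r\exp(i\theta)$ with $r=|c'|$ and $\theta:I\to\mathbb{R}$ continuous (unique up to adding a constant in $2\pi\mathbb{Z}$), one has $F_{a,b}(c)=2b\,r^{1/2}\exp\left(i\theta\frac{a}{2b}\right)$. In general $F_{a,b}$ is multivalued because of the choice of $\theta$; near a given $c$ it is made a well-defined smooth map by choosing, for curves $\widetilde c$ that are $C^\infty$-close to $c$, the continuous argument $\widetilde\theta$ of $\widetilde c'$ that is close to $\theta$. The differential $DF_{a,b}(c)(h)=\frac{d}{d\epsilon}\big|_{\epsilon=0}F_{a,b}(c+\epsilon h)$ refers to such a local representation. *)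

theory Defs
  imports "HOL-Analysis.Analysis"
begin

(* A curve on I = [0,1] is a function real => complex of which only the values on {0..1} matter;
   derivatives at the endpoints are one-sided. *)

definition deriv_I :: "(real \<Rightarrow> complex) \<Rightarrow> real \<Rightarrow> complex" where
  "deriv_I c = (\<lambda>t. vector_derivative c (at t within {0..1}))"

definition Cinf :: "(real \<Rightarrow> complex) set" where
  "Cinf = {c. \<forall>n. \<forall>t\<in>{0..1}. (deriv_I ^^ n) c differentiable (at t within {0..1})}"

definition Cinf_star :: "(real \<Rightarrow> complex) set" where
  "Cinf_star = {q \<in> Cinf. \<forall>t\<in>{0..1}. q t \<noteq> 0}"

definition Imm :: "(real \<Rightarrow> complex) set" where
  "Imm = {c \<in> Cinf. \<forall>t\<in>{0..1}. deriv_I c t \<noteq> 0}"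

(* Imm(I,C)/Tra, each class being represented by its element starting at the origin *)
definition Imm_Tra :: "(real \<Rightarrow> complex) set" where
  "Imm_Tra = {c \<in> Imm. c 0 = 0}"

definition tangent_Tra :: "(real \<Rightarrow> complex) set" where
  "tangent_Tra = {h \<in> Cinf. h 0 = 0}"

definition unit_tangent :: "(real \<Rightarrow> complex) \<Rightarrow> real \<Rightarrow> complex" where
  "unit_tangent c t = deriv_I c t /\<^sub>R cmod (deriv_I c t)"

definition unit_normal :: "(real \<Rightarrow> complex) \<Rightarrow> real \<Rightarrow> complex" where
  "unit_normal c t = \<i> * unit_tangent c t"

definition D_s :: "(real \<Rightarrow> complex) \<Rightarrow> (real \<Rightarrow> complex) \<Rightarrow> real \<Rightarrow> complex" where
  "D_s c h t = deriv_I h t /\<^sub>R cmod (deriv_I c t)"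

(* The inner product of the library on complex is Re (z * cnj w).
   The final factor is the density of ds with respect to dt. *)
definition g_elastic ::
    "real \<Rightarrow> real \<Rightarrow> (real \<Rightarrow> complex) \<Rightarrow> (real \<Rightarrow> complex) \<Rightarrow> (real \<Rightarrow> complex) \<Rightarrow> real" where
  "g_elastic a b c h k = integral {0..1} (\<lambda>t.
     (a\<^sup>2 * (D_s c h t \<bullet> unit_normal c t) * (D_s c k t \<bullet> unit_normal c t)
      + b\<^sup>2 * (D_s c h t \<bullet> unit_tangent c t) * (D_s c k t \<bullet> unit_tangent c t))
     * cmod (deriv_I c t))"

(* The L2 metric does not depend on the base point q. *)
definition g_L2 :: "(real \<Rightarrow> complex) \<Rightarrow> (real \<Rightarrow> complex) \<Rightarrow> (real \<Rightarrow> complex) \<Rightarrow> real" where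
  "g_L2 q w z = Re (integral {0..1} (\<lambda>t. w t * cnj (z t)))"

definition continuous_arg :: "(real \<Rightarrow> complex) \<Rightarrow> (real \<Rightarrow> real) \<Rightarrow> bool" where
  "continuous_arg c \<theta> \<longleftrightarrow> continuous_on {0..1} \<theta> \<and>
     (\<forall>t\<in>{0..1}. deriv_I c t = of_real (cmod (deriv_I c t)) * exp (\<i> * of_real (\<theta> t)))"

definition F_arg :: "real \<Rightarrow> real \<Rightarrow> (real \<Rightarrow> complex) \<Rightarrow> (real \<Rightarrow> real) \<Rightarrow> real \<Rightarrow> complex" where
  "F_arg a b c \<theta> t =
     of_real (2 * b * sqrt (cmod (deriv_I c t))) * exp (\<i> * of_real (\<theta> t * (a / (2 * b))))"

(* Continuous arguments of the same curve differ by a constant multiple of 2 pi, so on {0..1}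
   there is at most one at distance less than pi from a given \<theta>; see the lemmas below. *)
definition near_arg :: "(real \<Rightarrow> real) \<Rightarrow> (real \<Rightarrow> complex) \<Rightarrow> real \<Rightarrow> real" where
  "near_arg \<theta> c = (SOME \<theta>'. continuous_arg c \<theta>' \<and> (\<forall>t\<in>{0..1}. \<bar>\<theta>' t - \<theta> t\<bar> < pi))"

(* The local representation of the multivalued transform determined by a choice of argument \<theta>:
   it is meant for curves close to an immersion whose derivative has argument \<theta>. *)
definition F_local :: "real \<Rightarrow> real \<Rightarrow> (real \<Rightarrow> real) \<Rightarrow> (real \<Rightarrow> complex) \<Rightarrow> real \<Rightarrow> complex" where
  "F_local a b \<theta> c = F_arg a b c (near_arg \<theta> c)"

definition line_through ::
    "(real \<Rightarrow> complex) \<Rightarrow> (real \<Rightarrow> complex) \<Rightarrow> real \<Rightarrow> real \<Rightarrow> complex" where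
  "line_through c h \<epsilon> = (\<lambda>t. c t + of_real \<epsilon> * h t)"

(* W is the derivative at \<epsilon> = 0 of the path \<epsilon> \<mapsto> G \<epsilon> in the Frechet space of smooth
   curves: all derivatives of the difference quotients converge uniformly. *)
definition has_Cinf_derivative ::
    "(real \<Rightarrow> real \<Rightarrow> complex) \<Rightarrow> (real \<Rightarrow> complex) \<Rightarrow> bool" where
  "has_Cinf_derivative G W \<longleftrightarrow>
     (\<forall>\<^sub>F \<epsilon> in nhds 0. G \<epsilon> \<in> Cinf) \<and> W \<in> Cinf \<and>
     (\<forall>n. uniform_limit {0..1}
        (\<lambda>\<epsilon>. (deriv_I ^^ n) (\<lambda>t. (G \<epsilon> t - G 0 t) /\<^sub>R \<epsilon>)) ((deriv_I ^^ n) W) (at 0))"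

definition DF :: "((real \<Rightarrow> complex) \<Rightarrow> real \<Rightarrow> complex) \<Rightarrow>
    (real \<Rightarrow> complex) \<Rightarrow> (real \<Rightarrow> complex) \<Rightarrow> real \<Rightarrow> complex" where
  "DF F c h t = vector_derivative (\<lambda>\<epsilon>. F (line_through c h \<epsilon>) t) (at 0)"

lemma continuous_on_deriv_I:
  assumes "c \<in> Cinf"
  shows "continuous_on {0..1} (deriv_I c)"
proof -
  have "\<forall>t\<in>{0..1}. (deriv_I ^^ 1) c differentiable (at t within {0..1})"
    using assms unfolding Cinf_def by blast
  then show ?thesis
    by (auto simp: continuous_on_eq_continuous_within intro: differentiable_imp_continuous_within)
qed

lemma continuous_arg_exists:
  assumes "c \<in> Imm"
  shows "\<exists>\<theta>. continuous_arg c \<theta>"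
proof -
  have "continuous_on {0..1} (deriv_I c)" "\<And>t. t \<in> {0..1} \<Longrightarrow> deriv_I c t \<noteq> 0"
    using assms continuous_on_deriv_I by (auto simp: Imm_def)
  then obtain g where g: "continuous_on {0..1} g" "\<And>t. t \<in> {0..1} \<Longrightarrow> deriv_I c t = exp (g t)"
    using continuous_logarithm_on_contractible[of "{0..1}" "deriv_I c"]
    by (metis convex_imp_contractible convex_real_interval(5))
  have "deriv_I c t = of_real (cmod (deriv_I c t)) * exp (\<i> * of_real (Im (g t)))"
    if "t \<in> {0..1}" for t
    unfolding g(2)[OF that] norm_exp_eq_Re using exp_eq_polar[of "g t"] by (simp add: cis_conv_exp)
  then have "continuous_arg c (\<lambda>t. Im (g t))"
    unfolding continuous_arg_def using continuous_on_Im[OF g(1)] by blast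
  then show ?thesis by blast
qed

lemma near_arg_unique:
  assumes "c \<in> Imm" "continuous_arg c \<theta>1" "continuous_arg c \<theta>2"
    and "\<forall>t\<in>{0..1}. \<bar>\<theta>1 t - \<theta> t\<bar> < pi" "\<forall>t\<in>{0..1}. \<bar>\<theta>2 t - \<theta> t\<bar> < pi"
    and t: "t \<in> {0..1}"
  shows "\<theta>1 t = \<theta>2 t"
proof -
  have "deriv_I c t \<noteq> 0" using assms(1) t by (auto simp: Imm_def)
  moreover have "of_real (cmod (deriv_I c t)) * exp (\<i> * of_real (\<theta>1 t)) =
      of_real (cmod (deriv_I c t)) * exp (\<i> * of_real (\<theta>2 t))"
    using assms(2,3) t unfolding continuous_arg_def by metis
  ultimately have "exp (\<i> * of_real (\<theta>1 t)) = exp (\<i> * of_real (\<theta>2 t))" by simp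
  moreover have "\<bar>\<theta>1 t - \<theta>2 t\<bar> < 2 * pi"
    using bspec[OF assms(4) t] bspec[OF assms(5) t] by arith
  ultimately have "\<i> * of_real (\<theta>1 t) = \<i> * of_real (\<theta>2 t)"
    using exp_complex_eqI[of "\<i> * of_real (\<theta>1 t)" "\<i> * of_real (\<theta>2 t)"] by simp
  then show ?thesis by simp
qed

lemma near_arg:
  assumes "c \<in> Imm" "c' \<in> Imm" "continuous_arg c \<theta>"
    and close: "\<forall>t\<in>{0..1}. cmod (deriv_I c' t - deriv_I c t) < cmod (deriv_I c t)"
  shows "continuous_arg c' (near_arg \<theta> c')"
    and "\<forall>t\<in>{0..1}. \<bar>near_arg \<theta> c' t - \<theta> t\<bar> < pi"
proof -
  define u where "u t = deriv_I c' t / deriv_I c t" for t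
  define \<theta>' where "\<theta>' t = \<theta> t + Im (Ln (u t))" for t
  have nz: "deriv_I c t \<noteq> 0" "deriv_I c' t \<noteq> 0" if "t \<in> {0..1}" for t
    using assms(1,2) that by (auto simp: Imm_def)
  have re: "Re (u t) > 0" if t: "t \<in> {0..1}" for t
  proof -
    have "u t - 1 = (deriv_I c' t - deriv_I c t) / deriv_I c t"
      using nz(1)[OF t] by (simp add: u_def field_simps)
    then have "cmod (u t - 1) < 1"
      using close t nz(1)[OF t] by (simp add: norm_divide)
    then show ?thesis using abs_Re_le_cmod[of "u t - 1"] by simp
  qed
  have cont: "continuous_on {0..1} (deriv_I c)" "continuous_on {0..1} (deriv_I c')"
    using assms(1,2) continuous_on_deriv_I by (auto simp: Imm_def)
  have "continuous_on {0..1} u"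
    unfolding u_def using cont nz by (intro continuous_intros) auto
  moreover have "u t \<notin> \<real>\<^sub>\<le>\<^sub>0" if "t \<in> {0..1}" for t
    using re[OF that] by (auto simp: complex_nonpos_Reals_iff)
  ultimately have "continuous_on {0..1} (\<lambda>t. Ln (u t))"
    by (intro continuous_intros) auto
  then have "continuous_on {0..1} (\<lambda>t. Im (Ln (u t)))"
    by (rule continuous_on_Im)
  moreover have "continuous_on {0..1} \<theta>"
    using assms(3) by (simp add: continuous_arg_def)
  ultimately have 1: "continuous_on {0..1} \<theta>'"
    unfolding \<theta>'_def by (rule continuous_on_add[rotated])
  have 2: "deriv_I c' t = of_real (cmod (deriv_I c' t)) * exp (\<i> * of_real (\<theta>' t))"
    if t: "t \<in> {0..1}" for t
  proof -
    have "u t \<noteq> 0" using nz t by (simp add: u_def)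
    then have "u t = of_real (cmod (u t)) * exp (\<i> * of_real (Im (Ln (u t))))"
      by (metis exp_Ln exp_eq_polar cis_conv_exp norm_exp_eq_Re)
    moreover have "deriv_I c t = of_real (cmod (deriv_I c t)) * exp (\<i> * of_real (\<theta> t))"
      using assms(3) t by (auto simp: continuous_arg_def)
    ultimately have "deriv_I c t * u t =
        (of_real (cmod (deriv_I c t)) * exp (\<i> * of_real (\<theta> t))) *
        (of_real (cmod (u t)) * exp (\<i> * of_real (Im (Ln (u t)))))"
      by (rule arg_cong2[where f = "(*)", rotated])
    also have "\<dots> = of_real (cmod (deriv_I c t * u t)) * exp (\<i> * of_real (\<theta>' t))"
      by (simp only: \<theta>'_def of_real_add distrib_left exp_add norm_mult of_real_mult mult_ac)
    finally show ?thesis using nz(1)[OF t] by (simp add: u_def)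
  qed
  have 3: "\<bar>\<theta>' t - \<theta> t\<bar> < pi" if t: "t \<in> {0..1}" for t
  proof -
    have "u t \<noteq> 0" using nz t by (simp add: u_def)
    then have "\<bar>Im (Ln (u t))\<bar> < pi / 2"
      using Re_Ln_pos_lt re[OF t] by blast
    moreover have "pi / 2 < pi" using pi_gt_zero by simp
    ultimately show ?thesis unfolding \<theta>'_def by linarith
  qed
  have "continuous_arg c' \<theta>' \<and> (\<forall>t\<in>{0..1}. \<bar>\<theta>' t - \<theta> t\<bar> < pi)"
    using 1 2 3 unfolding continuous_arg_def by blast
  then have "continuous_arg c' (near_arg \<theta> c') \<and> (\<forall>t\<in>{0..1}. \<bar>near_arg \<theta> c' t - \<theta> t\<bar> < pi)"
    unfolding near_arg_def
    by (rule someI[where P = "\<lambda>\<theta>'. continuous_arg c' \<theta>' \<and> (\<forall>t\<in>{0..1}. \<bar>\<theta>' t - \<theta> t\<bar> < pi)"])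
  then show "continuous_arg c' (near_arg \<theta> c')"
    and "\<forall>t\<in>{0..1}. \<bar>near_arg \<theta> c' t - \<theta> t\<bar> < pi" by auto
qed

lemma F_local_eq_F_arg:
  assumes "c \<in> Imm" "continuous_arg c \<theta>" "t \<in> {0..1}"
  shows "F_local a b \<theta> c t = F_arg a b c \<theta> t"
proof -
  have "\<forall>t\<in>{0..1}. cmod (deriv_I c t - deriv_I c t) < cmod (deriv_I c t)"
    using assms(1) by (auto simp: Imm_def)
  note near = near_arg[OF assms(1,1,2) this]
  have "near_arg \<theta> c t = \<theta> t"
    using near_arg_unique[OF assms(1) near(1) assms(2) near(2) _ assms(3)] by simp
  then show ?thesis by (simp add: F_local_def F_arg_def)
qed

end

theory Submission
  imports Defs
begin

text \<open>
  Write \<open>c' = exp g\<close> with \<open>g = log r + \<i> \<theta>\<close>. The transform is then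
  \<open>F(c) = 2 b exp (S g)\<close> where \<open>S z = Re z / 2 + \<i> (a / 2 b) Im z\<close> is real-linear: up to the
  stretch \<open>S\<close>, \<open>F\<close> only takes a logarithm and an exponential. A variation \<open>c + \<epsilon> h\<close> multiplies
  \<open>c'\<close> by \<open>1 + \<epsilon> u\<close> with \<open>u = h' / c'\<close>. For small \<open>\<epsilon>\<close> the argument that stays close to \<open>\<theta>\<close>
  belongs to the logarithm \<open>g + Ln (1 + \<epsilon> u)\<close>, so that
  \<open>F(c + \<epsilon> h) = F(c) exp (S (Ln (1 + \<epsilon> u)))\<close> (lemma \<open>F_local_line_through\<close>) and
  \<open>DF(c)(h) = F(c) S u\<close> (lemma \<open>DF_F_local\<close>).

  The real and imaginary parts of \<open>u = h' / c'\<close> are the tangential and normal components of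
  \<open>D\<^sub>s h\<close>. Since \<open>|F(c)|\<^sup>2 = 4 b\<^sup>2 |c'|\<close>, the integrand of the \<open>L\<^sup>2\<close> metric is
  \<open>4 b\<^sup>2 |c'| (Re u Re v / 4 + (a / 2 b)\<^sup>2 Im u Im v)\<close> with \<open>v = k' / c'\<close>, which is the elastic
  integrand (lemma \<open>g_L2_DF_F_local\<close>).

  The analytic content is that \<open>DF(c)(h)\<close> is a derivative in the topology of smooth curves, i.e. that
  every \<open>t\<close>-derivative of the difference quotient in \<open>\<epsilon>\<close> converges uniformly. The family
  \<open>E = exp (S (Ln (1 + \<epsilon> u)))\<close> satisfies \<open>E' = \<epsilon> E S (u' / (1 + \<epsilon> u))\<close>. The factor \<open>\<epsilon>\<close> cancels
  in the derivative of \<open>(E - 1) / \<epsilon>\<close>, so that convergence of the quotient in \<open>C\<^sup>n\<^sup>+\<^sup>1\<close> follows from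
  its uniform convergence and the convergence of \<open>E\<close> and \<open>1 / (1 + \<epsilon> u)\<close> to \<open>1\<close> in \<open>C\<^sup>n\<close>
  (lemma \<open>Ck_tendsto_difference_quotient\<close>).
\<close>

section \<open>Smooth functions on the unit interval\<close>

abbreviation has_deriv_I :: "(real \<Rightarrow> complex) \<Rightarrow> (real \<Rightarrow> complex) \<Rightarrow> bool" where
  "has_deriv_I f f' \<equiv> \<forall>t\<in>{0..1}. (f has_vector_derivative f' t) (at t within {0..1})"

text \<open>
  Derivatives enter through existentially quantified witnesses instead of iterates of \<open>deriv_I\<close>:
  the value of \<open>deriv_I f\<close> outside the interval is arbitrary, so the iterates obey the
  rules of calculus only on the interval, whereas witnesses can be chosen in any convenient form.
\<close>

primrec Ck :: "nat \<Rightarrow> (real \<Rightarrow> complex) \<Rightarrow> bool" where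
  "Ck 0 f \<longleftrightarrow> continuous_on {0..1} f"
| "Ck (Suc n) f \<longleftrightarrow> (\<exists>f'. has_deriv_I f f' \<and> Ck n f')"

lemma has_deriv_I_imp_continuous_on: "has_deriv_I f f' \<Longrightarrow> continuous_on {0..1} f"
  by (auto intro: continuous_on_vector_derivative)

lemma deriv_I_eqI: "has_deriv_I f f' \<Longrightarrow> t \<in> {0..1} \<Longrightarrow> deriv_I f t = f' t"
  unfolding deriv_I_def by (intro vector_derivative_within_closed_interval) auto

lemma has_deriv_I_cong:
  assumes "\<And>t. t \<in> {0..1} \<Longrightarrow> f t = g t" "has_deriv_I f f'"
  shows "has_deriv_I g f'"
  using assms has_vector_derivative_transform[of _ "{0..1}" g f] by force

text \<open>
  As \<open>deriv_I\<close> differentiates within the interval, values outside do not influence it there, and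
  identities that hold only on the interval may be differentiated repeatedly.
\<close>

lemma funpow_deriv_I_cong:
  assumes "\<And>t. t \<in> {0..1} \<Longrightarrow> f t = g t" "t \<in> {0..1}"
  shows "(deriv_I ^^ n) f t = (deriv_I ^^ n) g t"
  using assms
proof (induction n arbitrary: t)
  case (Suc n)
  have "\<forall>\<^sub>F s in nhds t. s \<in> {0..1} \<longrightarrow> (deriv_I ^^ n) f s = (deriv_I ^^ n) g s"
    using Suc by (intro always_eventually) blast
  then show ?case
    unfolding funpow.simps o_apply deriv_I_def[of "(deriv_I ^^ n) _"]
    using Suc.prems(2) by (intro vector_derivative_cong_eq) auto
qed simp

lemma Ck_cong:
  assumes "Ck n f" "\<And>t. t \<in> {0..1} \<Longrightarrow> f t = g t"
  shows "Ck n g"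
proof (cases n)
  case 0
  then show ?thesis using assms continuous_on_cong[of "{0..1}" "{0..1}" f g] by simp
next
  case (Suc m)
  then show ?thesis using assms has_deriv_I_cong[of f g] by auto
qed

lemma Ck_SucD: "Ck (Suc n) f \<Longrightarrow> Ck n f"
  by (induction n arbitrary: f) (auto intro: has_deriv_I_imp_continuous_on)

lemma has_deriv_I_deriv_I: "f \<in> Cinf \<Longrightarrow> has_deriv_I f (deriv_I f)"
  unfolding Cinf_def deriv_I_def
  by (auto simp: vector_derivative_works[symmetric] dest: spec[of _ "0::nat"])

lemma deriv_I_Cinf: "f \<in> Cinf \<Longrightarrow> deriv_I f \<in> Cinf"
  unfolding Cinf_def mem_Collect_eq by (metis funpow_Suc_right o_apply)

lemma Cinf_iff_Ck: "f \<in> Cinf \<longleftrightarrow> (\<forall>n. Ck n f)"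
proof
  show "\<forall>n. Ck n f" if "f \<in> Cinf"
  proof
    fix n
    show "Ck n f" using that
    proof (induction n arbitrary: f)
      case 0
      from has_deriv_I_imp_continuous_on[OF has_deriv_I_deriv_I[OF 0]] show ?case by simp
    next
      case (Suc n)
      show ?case unfolding Ck.simps(2)
        using has_deriv_I_deriv_I[OF Suc.prems] Suc.IH[OF deriv_I_Cinf[OF Suc.prems]] by blast
    qed
  qed
  assume *: "\<forall>n. Ck n f"
  have "\<forall>k. Ck k ((deriv_I ^^ n) f)" for n
  proof (induction n)
    case (Suc n)
    show ?case
    proof
      fix k
      obtain g where "has_deriv_I ((deriv_I ^^ n) f) g" "Ck k g"
        using Suc[rule_format, of "Suc k"] by auto
      then show "Ck k ((deriv_I ^^ Suc n) f)"
        using Ck_cong[of k g] deriv_I_eqI by force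
    qed
  qed (use * in simp)
  \<comment> \<open>Differentiability of the \<open>n\<close>-th iterate takes one more order than its continuity.\<close>
  then have "Ck (Suc 0) ((deriv_I ^^ n) f)" for n by blast
  then show "f \<in> Cinf"
    unfolding Cinf_def Ck.simps by (blast intro: differentiableI_vector)
qed

lemma Ck_const: "Ck n (\<lambda>_. z)"
proof (induction n arbitrary: z)
  case (Suc n)
  then show ?case by (auto intro!: exI[of _ "\<lambda>_. 0"])
qed simp

lemma Ck_bounded_linear:
  assumes "bounded_linear L" "Ck n f"
  shows "Ck n (\<lambda>t. L (f t))"
  using assms(2)
proof (induction n arbitrary: f)
  case 0
  then show ?case using bounded_linear.continuous_on[OF assms(1)] by simp
next
  case (Suc n)
  then obtain f' where "has_deriv_I f f'" "Ck n f'" by auto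
  then show ?case using Suc.IH bounded_linear.has_vector_derivative[OF assms(1)]
    by (auto intro!: exI[of _ "\<lambda>t. L (f' t)"])
qed

lemma Ck_add:
  assumes "Ck n f" "Ck n g"
  shows "Ck n (\<lambda>t. f t + g t)"
  using assms
proof (induction n arbitrary: f g)
  case 0
  then show ?case by (simp add: continuous_on_add)
next
  case (Suc n)
  then obtain f' g' where "has_deriv_I f f'" "Ck n f'" "has_deriv_I g g'" "Ck n g'" by auto
  then show ?case using Suc.IH
    by (auto intro!: exI[of _ "\<lambda>t. f' t + g' t"] has_vector_derivative_add)
qed

lemma Ck_mult:
  assumes "Ck n f" "Ck n g"
  shows "Ck n (\<lambda>t. f t * g t)"
  using assms
proof (induction n arbitrary: f g)
  case 0
  then show ?case by (simp add: continuous_on_mult)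
next
  case (Suc n)
  then obtain f' g' where fg: "has_deriv_I f f'" "Ck n f'" "has_deriv_I g g'" "Ck n g'" by auto
  have "Ck n (\<lambda>t. f t * g' t + f' t * g t)"
    using Ck_SucD[OF Suc.prems(1)] Ck_SucD[OF Suc.prems(2)] fg(2,4) by (intro Ck_add Suc.IH)
  then show ?case using fg
    by (auto intro!: exI[of _ "\<lambda>t. f t * g' t + f' t * g t"] has_vector_derivative_mult)
qed

lemma has_vector_derivative_compose_field:
  assumes "(f has_vector_derivative f') (at t within S)" "(g has_field_derivative g') (at (f t))"
  shows "((\<lambda>t. g (f t)) has_vector_derivative f' * g') (at t within S)"
  using field_vector_diff_chain_within[OF assms(1) has_field_derivative_at_within[OF assms(2)]]
  by (simp add: o_def)

lemma has_deriv_I_inverse: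
  assumes "has_deriv_I f f'" "\<And>t. t \<in> {0..1} \<Longrightarrow> f t \<noteq> 0"
  shows "has_deriv_I (\<lambda>t. inverse (f t)) (\<lambda>t. - (f' t * (inverse (f t) * inverse (f t))))"
proof
  fix t :: real assume t: "t \<in> {0..1}"
  have "(f has_vector_derivative f' t) (at t within {0..1})" using assms(1) t by blast
  from has_vector_derivative_compose_field[OF this DERIV_inverse'[OF DERIV_ident]]
  show "((\<lambda>t. inverse (f t)) has_vector_derivative
      - (f' t * (inverse (f t) * inverse (f t)))) (at t within {0..1})"
    using assms(2)[OF t] by simp
qed

lemma Ck_inverse:
  assumes "\<And>t. t \<in> {0..1} \<Longrightarrow> f t \<noteq> 0" "Ck n f"
  shows "Ck n (\<lambda>t. inverse (f t))"
  using assms(2)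
proof (induction n)
  case 0
  then show ?case using assms(1) by (simp add: continuous_on_inverse)
next
  case (Suc n)
  then obtain f' where f': "has_deriv_I f f'" "Ck n f'" by auto
  have "Ck n (\<lambda>t. - (f' t * (inverse (f t) * inverse (f t))))"
    using Suc.IH[OF Ck_SucD[OF Suc.prems]] f'(2)
    by (intro Ck_bounded_linear[OF bounded_linear_minus[OF bounded_linear_ident]] Ck_mult)
  then show ?case using has_deriv_I_inverse[OF f'(1) assms(1)] by auto
qed

text \<open>
  Bootstrapping: the equation turns \<open>n\<close> derivatives of \<open>f\<close> into \<open>n + 1\<close>. This gives the smoothness
  of exponentials without differentiating a composition repeatedly.
\<close>

lemma Ck_linear_ode:
  assumes "has_deriv_I f (\<lambda>t. f t * w t)" "\<And>n. Ck n w"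
  shows "Ck n f"
proof (induction n)
  case 0
  then show ?case using has_deriv_I_imp_continuous_on[OF assms(1)] by simp
next
  case (Suc n)
  then show ?case using assms Ck_mult by auto
qed

section \<open>Convergence of families of smooth functions\<close>

text \<open>
  Convergence in \<open>C\<^sup>n\<close> along an arbitrary filter. The derivatives of \<open>G x\<close> are required only
  eventually, because the families of interest involve \<open>Ln (1 + \<epsilon> u)\<close> and are differentiable only
  for small \<open>\<epsilon>\<close>. Continuity of the limit keeps it bounded, which uniform convergence of
  products needs.
\<close>

primrec Ck_tendsto ::
    "nat \<Rightarrow> 'x filter \<Rightarrow> ('x \<Rightarrow> real \<Rightarrow> complex) \<Rightarrow> (real \<Rightarrow> complex) \<Rightarrow> bool" where
  "Ck_tendsto 0 F G g \<longleftrightarrow> uniform_limit {0..1} G g F \<and> continuous_on {0..1} g"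
| "Ck_tendsto (Suc n) F G g \<longleftrightarrow> uniform_limit {0..1} G g F \<and>
     (\<exists>G' g'. (\<forall>\<^sub>F x in F. has_deriv_I (G x) (G' x)) \<and> has_deriv_I g g' \<and> Ck_tendsto n F G' g')"

lemma Ck_tendsto_uniform_limit: "Ck_tendsto n F G g \<Longrightarrow> uniform_limit {0..1} G g F"
  by (cases n) auto

lemma Ck_tendsto_continuous: "Ck_tendsto n F G g \<Longrightarrow> continuous_on {0..1} g"
  by (cases n) (auto intro: has_deriv_I_imp_continuous_on)

lemma Ck_tendsto_SucI:
  assumes "uniform_limit {0..1} G g F" "\<forall>\<^sub>F x in F. has_deriv_I (G x) (G' x)"
    and "has_deriv_I g g'" "Ck_tendsto n F G' g'"
  shows "Ck_tendsto (Suc n) F G g"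
  unfolding Ck_tendsto.simps(2) using assms by (intro conjI exI)

lemma Ck_tendsto_SucD: "Ck_tendsto (Suc n) F G g \<Longrightarrow> Ck_tendsto n F G g"
proof (induction n arbitrary: G g)
  case 0
  then show ?case using Ck_tendsto_continuous[OF 0] by simp
next
  case (Suc n)
  obtain G' g' where "uniform_limit {0..1} G g F" "\<forall>\<^sub>F x in F. has_deriv_I (G x) (G' x)"
    "has_deriv_I g g'" "Ck_tendsto (Suc n) F G' g'"
    using Suc.prems unfolding Ck_tendsto.simps(2)[of "Suc n"] by blast
  then show ?case using Suc.IH[of G' g'] unfolding Ck_tendsto.simps(2)[of n] by blast
qed

lemma Ck_tendsto_const: "Ck n g \<Longrightarrow> Ck_tendsto n F (\<lambda>_. g) g"
proof (induction n arbitrary: g)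
  case 0
  then show ?case by (simp add: uniform_limit_const)
next
  case (Suc n)
  then obtain g' where "has_deriv_I g g'" "Ck n g'" by auto
  then show ?case
    using Suc.IH by (intro Ck_tendsto_SucI[where G' = "\<lambda>_. g'" and g' = g'] uniform_limit_const) auto
qed

lemma Ck_tendsto_bounded_linear:
  assumes L: "bounded_linear L" and "Ck_tendsto n F G g"
  shows "Ck_tendsto n F (\<lambda>x t. L (G x t)) (\<lambda>t. L (g t))"
  using assms(2)
proof (induction n arbitrary: G g)
  case 0
  then show ?case
    using bounded_linear.continuous_on[OF L] bounded_linear.uniform_limit[OF L]
    unfolding Ck_tendsto.simps by blast
next
  case (Suc n)
  then obtain G' g' where G': "uniform_limit {0..1} G g F" "\<forall>\<^sub>F x in F. has_deriv_I (G x) (G' x)"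
    "has_deriv_I g g'" "Ck_tendsto n F G' g'" by auto
  have "\<forall>\<^sub>F x in F. has_deriv_I (\<lambda>t. L (G x t)) (\<lambda>t. L (G' x t))"
    using G'(2) by eventually_elim (auto intro: bounded_linear.has_vector_derivative[OF L])
  moreover have "has_deriv_I (\<lambda>t. L (g t)) (\<lambda>t. L (g' t))"
    using G'(3) by (auto intro: bounded_linear.has_vector_derivative[OF L])
  ultimately show ?case
    using bounded_linear.uniform_limit[OF L G'(1)] Suc.IH[OF G'(4)] by (intro Ck_tendsto_SucI)
qed

lemma Ck_tendsto_add:
  assumes "Ck_tendsto n F G g" "Ck_tendsto n F H h"
  shows "Ck_tendsto n F (\<lambda>x t. G x t + H x t) (\<lambda>t. g t + h t)"
  using assms
proof (induction n arbitrary: G g H h)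
  case 0
  then show ?case by (simp add: continuous_on_add uniform_limit_add)
next
  case (Suc n)
  obtain G' g' where G': "uniform_limit {0..1} G g F" "\<forall>\<^sub>F x in F. has_deriv_I (G x) (G' x)"
    "has_deriv_I g g'" "Ck_tendsto n F G' g'" using Suc.prems(1) by auto
  obtain H' h' where H': "uniform_limit {0..1} H h F" "\<forall>\<^sub>F x in F. has_deriv_I (H x) (H' x)"
    "has_deriv_I h h'" "Ck_tendsto n F H' h'" using Suc.prems(2) by auto
  have "\<forall>\<^sub>F x in F. has_deriv_I (\<lambda>t. G x t + H x t) (\<lambda>t. G' x t + H' x t)"
    using G'(2) H'(2) by eventually_elim (auto intro: has_vector_derivative_add)
  moreover have "has_deriv_I (\<lambda>t. g t + h t) (\<lambda>t. g' t + h' t)"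
    using G'(3) H'(3) by (auto intro: has_vector_derivative_add)
  ultimately show ?case
    using uniform_limit_add[OF G'(1) H'(1)] Suc.IH[OF G'(4) H'(4)] by (intro Ck_tendsto_SucI)
qed

lemma Ck_tendsto_mult:
  assumes "Ck_tendsto n F G g" "Ck_tendsto n F H h"
  shows "Ck_tendsto n F (\<lambda>x t. G x t * H x t) (\<lambda>t. g t * h t)"
  using assms
proof (induction n arbitrary: G g H h)
  case 0
  then show ?case
    by (auto intro!: continuous_on_mult uniform_lim_mult compact_imp_bounded
        compact_continuous_image)
next
  case (Suc n)
  obtain G' g' where G': "uniform_limit {0..1} G g F" "\<forall>\<^sub>F x in F. has_deriv_I (G x) (G' x)"
    "has_deriv_I g g'" "Ck_tendsto n F G' g'" using Suc.prems(1) by auto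
  obtain H' h' where H': "uniform_limit {0..1} H h F" "\<forall>\<^sub>F x in F. has_deriv_I (H x) (H' x)"
    "has_deriv_I h h'" "Ck_tendsto n F H' h'" using Suc.prems(2) by auto
  have "\<forall>\<^sub>F x in F. has_deriv_I (\<lambda>t. G x t * H x t) (\<lambda>t. G x t * H' x t + G' x t * H x t)"
    using G'(2) H'(2) by eventually_elim (auto intro: has_vector_derivative_mult)
  moreover have "has_deriv_I (\<lambda>t. g t * h t) (\<lambda>t. g t * h' t + g' t * h t)"
    using G'(3) H'(3) by (auto intro: has_vector_derivative_mult)
  moreover have "Ck_tendsto n F (\<lambda>x t. G x t * H' x t + G' x t * H x t)
      (\<lambda>t. g t * h' t + g' t * h t)"
    using Ck_tendsto_SucD[OF Suc.prems(1)] Ck_tendsto_SucD[OF Suc.prems(2)] G'(4) H'(4)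
    by (intro Ck_tendsto_add Suc.IH)
  moreover have "uniform_limit {0..1} (\<lambda>x t. G x t * H x t) (\<lambda>t. g t * h t) F"
    using G'(1) H'(1) has_deriv_I_imp_continuous_on[OF G'(3)] has_deriv_I_imp_continuous_on[OF H'(3)]
    by (auto intro!: uniform_lim_mult compact_imp_bounded compact_continuous_image)
  ultimately show ?case by (intro Ck_tendsto_SucI)
qed

lemma Ck_tendsto_scalar:
  assumes "(s \<longlongrightarrow> z) F"
  shows "Ck_tendsto n F (\<lambda>x _. s x) (\<lambda>_. z)"
proof -
  have "uniform_limit {0..1} (\<lambda>x _. s x) (\<lambda>_. z) F"
    using assms by (auto intro!: uniform_limitI elim: eventually_mono dest: tendstoD)
  moreover have "Ck_tendsto m F (\<lambda>_ _. 0) (\<lambda>_. 0)" for m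
    by (intro Ck_tendsto_const Ck_const)
  ultimately show ?thesis
    by (cases n) (auto intro!: exI[of _ "\<lambda>_ _. 0"] exI[of _ "\<lambda>_. 0"])
qed

lemma Ck_tendsto_funpow_deriv_I:
  assumes "Ck_tendsto n F G g"
  shows "uniform_limit {0..1} (\<lambda>x. (deriv_I ^^ n) (G x)) ((deriv_I ^^ n) g) F"
  using assms
proof (induction n arbitrary: G g)
  case (Suc n)
  then obtain G' g' where G': "\<forall>\<^sub>F x in F. has_deriv_I (G x) (G' x)"
    "has_deriv_I g g'" "Ck_tendsto n F G' g'" by auto
  have "\<forall>\<^sub>F x in F. \<forall>t\<in>{0..1}. (deriv_I ^^ n) (G' x) t = (deriv_I ^^ Suc n) (G x) t"
    using G'(1)
    by eventually_elim (auto simp: funpow_Suc_right deriv_I_eqI simp del: funpow.simps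
        intro!: funpow_deriv_I_cong)
  moreover have "(deriv_I ^^ n) g' t = (deriv_I ^^ Suc n) g t" if "t \<in> {0..1}" for t
    using G'(2) that by (auto simp: funpow_Suc_right deriv_I_eqI simp del: funpow.simps
        intro!: funpow_deriv_I_cong)
  ultimately show ?case using Suc.IH[OF G'(3)] by (rule uniform_limit_cong[THEN iffD1])
qed simp

section \<open>Real-linear functions of logarithms\<close>

text \<open>
  A continuous logarithm of a differentiable function is differentiable: near \<open>s\<close> its imaginary part
  moves by less than \<open>\<pi>\<close>, so there it is the principal logarithm of \<open>f / f s\<close> up to a constant.
\<close>

lemma has_deriv_I_continuous_log:
  assumes g: "continuous_on {0..1} g" and f: "has_deriv_I f f'"
    and fg: "\<And>t. t \<in> {0..1} \<Longrightarrow> f t = exp (g t)"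
  shows "has_deriv_I g (\<lambda>t. f' t / f t)"
proof
  fix s :: real assume s: "s \<in> {0..1}"
  obtain d where d: "d > 0" "\<And>t. t \<in> {0..1} \<Longrightarrow> dist t s < d \<Longrightarrow> dist (g t) (g s) < pi"
    using g s pi_gt_zero unfolding continuous_on_iff by meson
  have fs: "f s \<noteq> 0" using fg s by simp
  have "((\<lambda>t. f t / f s) has_vector_derivative f' s / f s) (at s within {0..1})"
    using f s by (auto intro: has_vector_derivative_divide)
  moreover have "(Ln has_field_derivative inverse (f s / f s)) (at (f s / f s))"
    using fs by (intro has_field_derivative_Ln) simp
  ultimately have "((\<lambda>t. Ln (f t / f s)) has_vector_derivative f' s / f s * inverse (f s / f s))
      (at s within {0..1})"
    by (rule has_vector_derivative_compose_field)
  from has_vector_derivative_add[OF has_vector_derivative_const this]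
  have "((\<lambda>t. g s + Ln (f t / f s)) has_vector_derivative f' s / f s) (at s within {0..1})"
    using fs by simp
  moreover have "g s + Ln (f t / f s) = g t" if t: "t \<in> {0..1}" "dist t s < d" for t
  proof -
    have "\<bar>Im (g t - g s)\<bar> < pi"
      using d(2)[OF t] abs_Im_le_cmod[of "g t - g s"] unfolding dist_norm by linarith
    then have "Ln (exp (g t - g s)) = g t - g s" by (intro Ln_exp) auto
    then show ?thesis using fg t s by (simp add: exp_diff)
  qed
  ultimately show "(g has_vector_derivative f' s / f s) (at s within {0..1})"
    by (rule has_vector_derivative_transform_within[OF _ d(1) s])
qed

lemma has_deriv_I_exp_linear:
  assumes "bounded_linear L" "has_deriv_I g g'"
  shows "has_deriv_I (\<lambda>t. exp (L (g t))) (\<lambda>t. exp (L (g t)) * L (g' t))"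
proof
  fix t :: real assume t: "t \<in> {0..1}"
  have "((\<lambda>t. L (g t)) has_vector_derivative L (g' t)) (at t within {0..1})"
    using assms(2) t by (blast intro: bounded_linear.has_vector_derivative[OF assms(1)])
  from has_vector_derivative_compose_field[OF this DERIV_exp]
  show "((\<lambda>t. exp (L (g t))) has_vector_derivative exp (L (g t)) * L (g' t))
      (at t within {0..1})"
    by (simp add: mult.commute)
qed

lemma bounded_linear_of_real_mult:
  "bounded_linear L \<Longrightarrow> L (of_real r * z) = of_real r * L z" for L :: "complex \<Rightarrow> complex"
  by (metis bounded_linear.linear linear_cmul scaleR_conv_of_real)

lemma one_plus_small_notin_nonpos_Reals:
  assumes "cmod z < 1"
  shows "1 + z \<notin> \<real>\<^sub>\<le>\<^sub>0" "1 + z \<noteq> 0"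
proof -
  have "Re (1 + z) > 0" using assms abs_Re_le_cmod[of z] by simp
  then show "1 + z \<notin> \<real>\<^sub>\<le>\<^sub>0" by (simp add: complex_nonpos_Reals_iff)
  then show "1 + z \<noteq> 0" by auto
qed

lemma continuous_on_I_bounded:
  fixes u :: "real \<Rightarrow> complex"
  assumes "continuous_on {0..1} u"
  obtains M where "M > 0" "\<And>t. t \<in> {0..1} \<Longrightarrow> cmod (u t) \<le> M"
proof -
  have "bounded (u ` {0..1})"
    by (rule compact_imp_bounded[OF compact_continuous_image[OF assms compact_Icc]])
  then show thesis unfolding bounded_pos using that by blast
qed

lemma eventually_scaled_small:
  fixes u :: "real \<Rightarrow> complex"
  assumes "continuous_on {0..1} u" "r > 0"
  shows "\<forall>\<^sub>F \<epsilon> in nhds 0. \<forall>t\<in>{0..1}. cmod (of_real \<epsilon> * u t) < r"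
proof -
  obtain M where M: "M > 0" "\<And>t. t \<in> {0..1} \<Longrightarrow> cmod (u t) \<le> M"
    using continuous_on_I_bounded assms(1) by blast
  have "\<forall>\<^sub>F \<epsilon> in nhds 0. dist \<epsilon> 0 < r / M"
    unfolding eventually_nhds_metric using assms(2) M(1) by (intro exI[of _ "r / M"]) simp
  then show ?thesis
  proof eventually_elim
    case (elim \<epsilon>)
    show ?case
    proof
      fix t :: real assume "t \<in> {0..1}"
      then have "\<bar>\<epsilon>\<bar> * cmod (u t) \<le> \<bar>\<epsilon>\<bar> * M" using M(2) by (intro mult_left_mono) auto
      also have "\<dots> < r" using elim M(1) by (simp add: field_simps)
      finally show "cmod (of_real \<epsilon> * u t) < r" by (simp add: norm_mult)
    qed
  qed
qed

lemma eventually_at_scaled_small: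
  fixes u :: "real \<Rightarrow> complex"
  assumes "continuous_on {0..1} u" "r > 0"
  shows "\<forall>\<^sub>F \<epsilon> in at 0. \<forall>t\<in>{0..1}. cmod (of_real \<epsilon> * u t) < r"
  using eventually_scaled_small[OF assms] unfolding eventually_at_filter
  by (rule eventually_mono) blast

text \<open>
  Since \<open>u\<close> is bounded, \<open>\<epsilon> u\<close> tends to \<open>0\<close> uniformly, so that the modulus of continuity
  of \<open>\<phi>\<close> at \<open>0\<close> serves all \<open>t\<close> at once.
\<close>

lemma uniform_limit_isCont_scaled:
  fixes u :: "real \<Rightarrow> complex" and \<phi> :: "complex \<Rightarrow> complex"
  assumes "continuous_on {0..1} u" "isCont \<phi> 0"
  shows "uniform_limit {0..1} (\<lambda>\<epsilon> t. \<phi> (of_real \<epsilon> * u t)) (\<lambda>_. \<phi> 0) (at 0)"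
proof (rule uniform_limitI)
  fix e :: real assume "e > 0"
  then obtain d where d: "d > 0" "\<And>z. cmod z < d \<Longrightarrow> dist (\<phi> z) (\<phi> 0) < e"
    using assms(2) unfolding continuous_at_eps_delta dist_norm by (metis diff_zero)
  show "\<forall>\<^sub>F \<epsilon> in at 0. \<forall>t\<in>{0..1}. dist (\<phi> (of_real \<epsilon> * u t)) (\<phi> 0) < e"
    using eventually_at_scaled_small[OF assms(1) d(1)] by eventually_elim (use d(2) in blast)
qed

lemma has_deriv_I_one_plus_scaled:
  assumes "u \<in> Cinf"
  shows "has_deriv_I (\<lambda>t. 1 + of_real \<epsilon> * u t) (\<lambda>t. of_real \<epsilon> * deriv_I u t)"
proof
  fix t :: real assume "t \<in> {0..1}"
  then have "(u has_vector_derivative deriv_I u t) (at t within {0..1})"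
    using has_deriv_I_deriv_I[OF assms] by blast
  from has_vector_derivative_add[OF has_vector_derivative_const
      has_vector_derivative_mult_right[OF this], of 1 "of_real \<epsilon>"]
  show "((\<lambda>t. 1 + of_real \<epsilon> * u t) has_vector_derivative
      of_real \<epsilon> * deriv_I u t) (at t within {0..1})" by simp
qed

text \<open>
  With \<open>V = 1 / (1 + \<epsilon> u)\<close> one has \<open>V' = - \<epsilon> u' V\<^sup>2\<close>. Convergence of \<open>V\<close> in \<open>C\<^sup>n\<close> therefore makes
  \<open>V'\<close> tend to \<open>0\<close> in \<open>C\<^sup>n\<close>, which is the induction step.
\<close>

lemma Ck_tendsto_inverse_one_plus:
  assumes u: "u \<in> Cinf"
  shows "Ck_tendsto n (at 0) (\<lambda>\<epsilon> t. inverse (1 + of_real \<epsilon> * u t)) (\<lambda>_. 1)"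
proof (induction n)
  have cont: "continuous_on {0..1} u"
    using has_deriv_I_imp_continuous_on[OF has_deriv_I_deriv_I[OF u]] .
  have lim: "uniform_limit {0..1} (\<lambda>\<epsilon> t. inverse (1 + of_real \<epsilon> * u t)) (\<lambda>_. 1) (at 0)"
  proof -
    have "isCont (\<lambda>z::complex. inverse (1 + z)) 0" by (intro continuous_intros) simp
    from uniform_limit_isCont_scaled[OF cont this] show ?thesis by simp
  qed
  {
    case 0
    show ?case using lim by simp
  next
    case (Suc n)
    let ?V = "\<lambda>\<epsilon> t. inverse (1 + of_real \<epsilon> * u t)"
    have "\<forall>\<^sub>F \<epsilon> in at 0. has_deriv_I (?V \<epsilon>)
        (\<lambda>t. of_real (- \<epsilon>) * (deriv_I u t * (?V \<epsilon> t * ?V \<epsilon> t)))"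
      using eventually_at_scaled_small[OF cont zero_less_one]
    proof eventually_elim
      case (elim \<epsilon>)
      then show ?case
        using has_deriv_I_inverse[OF has_deriv_I_one_plus_scaled[OF u, of \<epsilon>]]
          one_plus_small_notin_nonpos_Reals(2) by (simp add: mult.assoc)
    qed
    moreover have "Ck_tendsto n (at 0) (\<lambda>\<epsilon> t. of_real (- \<epsilon>) * (deriv_I u t * (?V \<epsilon> t * ?V \<epsilon> t)))
        (\<lambda>t. of_real (- 0) * (deriv_I u t * (1 * 1)))"
      using deriv_I_Cinf[OF u] Cinf_iff_Ck
      by (intro Ck_tendsto_mult Ck_tendsto_scalar Ck_tendsto_const Suc tendsto_intros) auto
    ultimately show ?case using lim by (intro Ck_tendsto_SucI) auto
  }
qed

lemma has_deriv_I_exp_linear_Ln: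
  assumes "bounded_linear L" "u \<in> Cinf" "\<And>t. t \<in> {0..1} \<Longrightarrow> cmod (of_real \<epsilon> * u t) < 1"
  shows "has_deriv_I (\<lambda>t. exp (L (Ln (1 + of_real \<epsilon> * u t))))
    (\<lambda>t. of_real \<epsilon> * (exp (L (Ln (1 + of_real \<epsilon> * u t))) *
      L (deriv_I u t * inverse (1 + of_real \<epsilon> * u t))))"
proof -
  have "has_deriv_I (\<lambda>t. Ln (1 + of_real \<epsilon> * u t))
      (\<lambda>t. of_real \<epsilon> * (deriv_I u t * inverse (1 + of_real \<epsilon> * u t)))"
  proof
    fix t :: real assume t: "t \<in> {0..1}"
    have "((\<lambda>t. 1 + of_real \<epsilon> * u t) has_vector_derivative of_real \<epsilon> * deriv_I u t)
        (at t within {0..1})"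
      using has_deriv_I_one_plus_scaled[OF assms(2)] t by blast
    from has_vector_derivative_compose_field[OF this has_field_derivative_Ln]
    show "((\<lambda>t. Ln (1 + of_real \<epsilon> * u t)) has_vector_derivative
        of_real \<epsilon> * (deriv_I u t * inverse (1 + of_real \<epsilon> * u t))) (at t within {0..1})"
      using one_plus_small_notin_nonpos_Reals(1)[OF assms(3)[OF t]] by (simp add: mult.assoc)
  qed
  from has_deriv_I_exp_linear[OF assms(1) this] show ?thesis
    by (simp add: bounded_linear_of_real_mult[OF assms(1)] mult_ac)
qed

lemma bounded_linear_zero_eq: "bounded_linear L \<Longrightarrow> L 0 = 0"
  by (simp add: bounded_linear.linear linear_0)

text \<open>
  The logarithm and the exponential contribute the factor \<open>1\<close> each, which leaves \<open>L\<close>. Since \<open>L\<close> is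
  real-linear, this is a Frechet derivative and in general not a complex one.
\<close>

lemma has_derivative_exp_linear_Ln:
  fixes L :: "complex \<Rightarrow> complex"
  assumes "bounded_linear L"
  shows "((\<lambda>z. exp (L (Ln (1 + z)))) has_derivative L) (at 0)"
proof -
  have "((\<lambda>z. Ln (1 + z)) has_derivative (\<lambda>z. z)) (at 0)"
  proof -
    have "((\<lambda>z. Ln (1 + z)) has_field_derivative 1) (at 0)"
      by (auto intro!: derivative_eq_intros)
    moreover have "(*) (1::complex) = (\<lambda>z. z)" by auto
    ultimately show ?thesis unfolding has_field_derivative_def by simp
  qed
  from bounded_linear.has_derivative[OF assms this]
  have "((\<lambda>z. exp (L (Ln (1 + z)))) has_derivative (\<lambda>z. exp (L (Ln (1 + 0))) * L z)) (at 0)"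
    using DERIV_exp[of "L (Ln (1 + 0))"] unfolding has_field_derivative_def
    by (rule has_derivative_compose)
  then show ?thesis using assms by (simp add: bounded_linear_zero_eq)
qed

text \<open>
  The factor \<open>\<epsilon>\<close> in \<open>has_deriv_I_exp_linear_Ln\<close> makes the derivative tend to \<open>0\<close> in \<open>C\<^sup>n\<close> as soon as
  the family itself converges there.
\<close>

lemma Ck_tendsto_exp_linear_Ln:
  assumes L: "bounded_linear L" and u: "u \<in> Cinf"
  shows "Ck_tendsto n (at 0) (\<lambda>\<epsilon> t. exp (L (Ln (1 + of_real \<epsilon> * u t)))) (\<lambda>_. 1)"
proof (induction n)
  have cont: "continuous_on {0..1} u"
    using has_deriv_I_imp_continuous_on[OF has_deriv_I_deriv_I[OF u]] .
  have lim: "uniform_limit {0..1} (\<lambda>\<epsilon> t. exp (L (Ln (1 + of_real \<epsilon> * u t)))) (\<lambda>_. 1) (at 0)"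
    using uniform_limit_isCont_scaled[OF cont
        has_derivative_continuous[OF has_derivative_exp_linear_Ln[OF L]]]
    by (simp add: bounded_linear_zero_eq[OF L])
  {
    case 0
    show ?case using lim by simp
  next
    case (Suc n)
    let ?E = "\<lambda>\<epsilon> t. exp (L (Ln (1 + of_real \<epsilon> * u t)))"
    let ?V = "\<lambda>\<epsilon> t. inverse (1 + of_real \<epsilon> * u t)"
    have "\<forall>\<^sub>F \<epsilon> in at 0. has_deriv_I (?E \<epsilon>)
        (\<lambda>t. of_real \<epsilon> * (?E \<epsilon> t * L (deriv_I u t * ?V \<epsilon> t)))"
      using eventually_at_scaled_small[OF cont zero_less_one]
      by eventually_elim (use has_deriv_I_exp_linear_Ln[OF L u] in blast)
    moreover have "Ck_tendsto n (at 0) (\<lambda>\<epsilon> t. of_real \<epsilon> * (?E \<epsilon> t * L (deriv_I u t * ?V \<epsilon> t)))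
        (\<lambda>t. of_real 0 * (1 * L (deriv_I u t * 1)))"
      using deriv_I_Cinf[OF u] Cinf_iff_Ck Ck_tendsto_inverse_one_plus[OF u]
      by (intro Ck_tendsto_mult Ck_tendsto_scalar Ck_tendsto_bounded_linear[OF L]
          Ck_tendsto_const Suc tendsto_intros) auto
    ultimately show ?case using lim by (intro Ck_tendsto_SucI) auto
  }
qed

text \<open>
  The remainder of \<open>\<phi>\<close> at \<open>z = \<epsilon> u\<close> is at most a small multiple of \<open>|\<epsilon>| |u|\<close>, and \<open>u\<close> is bounded.
\<close>

lemma uniform_limit_difference_quotient:
  fixes u :: "real \<Rightarrow> complex" and \<phi> :: "complex \<Rightarrow> complex"
  assumes u: "continuous_on {0..1} u" and \<phi>: "(\<phi> has_derivative L) (at 0)"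
  shows "uniform_limit {0..1} (\<lambda>\<epsilon> t. (\<phi> (of_real \<epsilon> * u t) - \<phi> 0) /\<^sub>R \<epsilon>) (\<lambda>t. L (u t)) (at 0)"
proof (rule uniform_limitI)
  fix e :: real assume "e > 0"
  have L: "bounded_linear L" using \<phi> by (rule has_derivative_bounded_linear)
  obtain M where M: "M > 0" "\<And>t. t \<in> {0..1} \<Longrightarrow> cmod (u t) \<le> M"
    using continuous_on_I_bounded u by blast
  \<comment> \<open>The factor \<open>2\<close> makes the final estimate strict.\<close>
  have "e / (2 * M) > 0" using \<open>e > 0\<close> M(1) by simp
  then obtain d where d: "d > 0"
    "\<And>z. cmod z < d \<Longrightarrow> cmod (\<phi> z - \<phi> 0 - L z) \<le> e / (2 * M) * cmod z"
    using \<phi> unfolding has_derivative_at_alt by (metis diff_zero)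
  have "\<forall>\<^sub>F \<epsilon> in at 0. (\<epsilon>::real) \<noteq> 0" by (simp add: eventually_at_filter)
  then show "\<forall>\<^sub>F \<epsilon> in at 0. \<forall>t\<in>{0..1}. dist ((\<phi> (of_real \<epsilon> * u t) - \<phi> 0) /\<^sub>R \<epsilon>) (L (u t)) < e"
    using eventually_at_scaled_small[OF u d(1)]
  proof eventually_elim
    case (elim \<epsilon>)
    show ?case
    proof
      fix t :: real assume t: "t \<in> {0..1}"
      let ?z = "of_real \<epsilon> * u t"
      have "(\<phi> ?z - \<phi> 0) /\<^sub>R \<epsilon> - L (u t) = (\<phi> ?z - \<phi> 0 - L ?z) /\<^sub>R \<epsilon>"
        using elim(1) by (simp add: bounded_linear_of_real_mult[OF L] scaleR_conv_of_real field_simps)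
      then have "dist ((\<phi> ?z - \<phi> 0) /\<^sub>R \<epsilon>) (L (u t)) = cmod (\<phi> ?z - \<phi> 0 - L ?z) / \<bar>\<epsilon>\<bar>"
        by (simp add: dist_norm divide_inverse mult.commute)
      also have "\<dots> \<le> e / (2 * M) * cmod ?z / \<bar>\<epsilon>\<bar>"
        using d(2) elim(2) t by (intro divide_right_mono) auto
      also have "\<dots> = e / (2 * M) * cmod (u t)" using elim(1) by (simp add: norm_mult)
      also have "\<dots> \<le> e / (2 * M) * M" using M(2)[OF t] \<open>e / (2 * M) > 0\<close>
        by (intro mult_left_mono) auto
      also have "\<dots> < e" using M(1) \<open>e > 0\<close> by simp
      finally show "dist ((\<phi> ?z - \<phi> 0) /\<^sub>R \<epsilon>) (L (u t)) < e" .
    qed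
  qed
qed

text \<open>
  The \<open>t\<close>-derivative of the quotient is \<open>E L (u' / (1 + \<epsilon> u))\<close>, with the \<open>1 / \<epsilon>\<close> cancelled. Its
  convergence in \<open>C\<^sup>n\<close> is that of \<open>E\<close> and of \<open>1 / (1 + \<epsilon> u)\<close>; the quotient itself only has to
  converge uniformly.
\<close>

lemma Ck_tendsto_difference_quotient:
  assumes L: "bounded_linear L" and u: "u \<in> Cinf"
  shows "Ck_tendsto n (at 0) (\<lambda>\<epsilon> t. (exp (L (Ln (1 + of_real \<epsilon> * u t))) - 1) /\<^sub>R \<epsilon>) (\<lambda>t. L (u t))"
proof -
  let ?E = "\<lambda>\<epsilon> t. exp (L (Ln (1 + of_real \<epsilon> * u t)))"
  let ?V = "\<lambda>\<epsilon> t. inverse (1 + of_real \<epsilon> * u t)"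
  have u': "has_deriv_I u (deriv_I u)" using u by (rule has_deriv_I_deriv_I)
  then have cont: "continuous_on {0..1} u" by (rule has_deriv_I_imp_continuous_on)
  have lim: "uniform_limit {0..1} (\<lambda>\<epsilon> t. (?E \<epsilon> t - 1) /\<^sub>R \<epsilon>) (\<lambda>t. L (u t)) (at 0)"
    using uniform_limit_difference_quotient[OF cont has_derivative_exp_linear_Ln[OF L]]
    by (simp add: bounded_linear_zero_eq[OF L])
  show ?thesis
  proof (cases n)
    case 0
    then show ?thesis using lim bounded_linear.continuous_on[OF L cont] by simp
  next
    case (Suc m)
    have "\<forall>\<^sub>F \<epsilon> in at 0. (\<epsilon>::real) \<noteq> 0" by (simp add: eventually_at_filter)
    then have "\<forall>\<^sub>F \<epsilon> in at 0. has_deriv_I (\<lambda>t. (?E \<epsilon> t - 1) /\<^sub>R \<epsilon>)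
        (\<lambda>t. ?E \<epsilon> t * L (deriv_I u t * ?V \<epsilon> t))"
      using eventually_at_scaled_small[OF cont zero_less_one]
    proof eventually_elim
      case (elim \<epsilon>)
      show ?case
      proof
        fix t :: real assume "t \<in> {0..1}"
        then have "(?E \<epsilon> has_vector_derivative
            of_real \<epsilon> * (?E \<epsilon> t * L (deriv_I u t * ?V \<epsilon> t))) (at t within {0..1})"
          using has_deriv_I_exp_linear_Ln[OF L u] elim(2) by blast
        from bounded_linear.has_vector_derivative[OF bounded_linear_scaleR_right
            has_vector_derivative_diff[OF this has_vector_derivative_const], of "inverse \<epsilon>" 1]
        show "((\<lambda>t. (?E \<epsilon> t - 1) /\<^sub>R \<epsilon>) has_vector_derivative
            ?E \<epsilon> t * L (deriv_I u t * ?V \<epsilon> t)) (at t within {0..1})"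
          using elim(1) by (simp add: scaleR_conv_of_real field_simps)
      qed
    qed
    moreover have "Ck_tendsto m (at 0) (\<lambda>\<epsilon> t. ?E \<epsilon> t * L (deriv_I u t * ?V \<epsilon> t))
        (\<lambda>t. 1 * L (deriv_I u t * 1))"
      using deriv_I_Cinf[OF u] Cinf_iff_Ck Ck_tendsto_inverse_one_plus[OF u]
        Ck_tendsto_exp_linear_Ln[OF L u]
      by (intro Ck_tendsto_mult Ck_tendsto_bounded_linear[OF L] Ck_tendsto_const) auto
    moreover have "has_deriv_I (\<lambda>t. L (u t)) (\<lambda>t. 1 * L (deriv_I u t * 1))"
      using u' bounded_linear.has_vector_derivative[OF L] by simp
    ultimately show ?thesis using lim unfolding Suc by (intro Ck_tendsto_SucI)
  qed
qed

section \<open>The transform as a real-linear function of the logarithm of the velocity\<close>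

definition polar_log :: "(real \<Rightarrow> complex) \<Rightarrow> (real \<Rightarrow> real) \<Rightarrow> real \<Rightarrow> complex" where
  "polar_log c \<theta> t = of_real (ln (cmod (deriv_I c t))) + \<i> * of_real (\<theta> t)"

text \<open>
  The factor \<open>1 / 2\<close> on the real part is the square root of \<open>|c'|\<close>; the factor on the imaginary part
  is the exponent of \<open>c' / |c'|\<close>.
\<close>

definition stretch :: "real \<Rightarrow> real \<Rightarrow> complex \<Rightarrow> complex" where
  "stretch a b z = of_real (Re z / 2) + \<i> * of_real (a / (2 * b) * Im z)"

lemma bounded_linear_stretch: "bounded_linear (stretch a b)"
proof -
  have "linear (stretch a b)"
    by (rule linearI) (simp_all add: stretch_def complex_eq_iff ring_distribs add_divide_distrib)
  then show ?thesis by (simp add: linear_conv_bounded_linear)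
qed

lemma exp_polar_log:
  assumes "continuous_arg c \<theta>" "t \<in> {0..1}" "deriv_I c t \<noteq> 0"
  shows "exp (polar_log c \<theta> t) = deriv_I c t"
proof -
  have "exp (polar_log c \<theta> t) = of_real (cmod (deriv_I c t)) * exp (\<i> * of_real (\<theta> t))"
    using assms(3) by (simp add: polar_log_def exp_add exp_of_real)
  then show ?thesis using assms(1,2) by (simp add: continuous_arg_def)
qed

lemma F_arg_eq_exp_stretch:
  assumes "deriv_I c t \<noteq> 0"
  shows "F_arg a b c \<theta> t = of_real (2 * b) * exp (stretch a b (polar_log c \<theta> t))"
proof -
  have "exp (ln (cmod (deriv_I c t)) / 2) = sqrt (cmod (deriv_I c t))"
    using assms by (simp add: ln_sqrt[symmetric])
  then have "exp (complex_of_real (ln (cmod (deriv_I c t)) / 2)) = of_real (sqrt (cmod (deriv_I c t)))"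
    by (simp only: exp_of_real)
  then show ?thesis
    by (simp add: F_arg_def stretch_def polar_log_def exp_add mult.commute)
qed

text \<open>
  The logarithm of \<open>c'\<close> has the derivative \<open>w = c'' / c'\<close>, so that \<open>F(c)' = F(c) S w\<close> and \<open>F(c)\<close>
  inherits the smoothness of \<open>w\<close>. Applied to the curves \<open>c + \<epsilon> h\<close>, this lemma also shows that
  the local transform has smooth values.
\<close>

lemma F_arg_Cinf_star:
  assumes "b > 0" "c \<in> Imm" "continuous_arg c \<theta>"
  shows "F_arg a b c \<theta> \<in> Cinf_star"
proof -
  have c: "c \<in> Cinf" "deriv_I c \<in> Cinf" and nz: "\<And>t. t \<in> {0..1} \<Longrightarrow> deriv_I c t \<noteq> 0"
    using assms(2) deriv_I_Cinf by (auto simp: Imm_def)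
  let ?w = "\<lambda>t. deriv_I (deriv_I c) t / deriv_I c t"
  have "continuous_on {0..1} \<theta>" using assms(3) by (simp add: continuous_arg_def)
  then have "continuous_on {0..1} (polar_log c \<theta>)"
    unfolding polar_log_def using continuous_on_deriv_I[OF c(1)] nz
    by (intro continuous_intros) auto
  then have "has_deriv_I (polar_log c \<theta>) ?w"
    using has_deriv_I_deriv_I[OF c(2)] exp_polar_log[OF assms(3)] nz
    by (intro has_deriv_I_continuous_log) auto
  from has_deriv_I_exp_linear[OF bounded_linear_stretch[of a b] this]
  have E: "has_deriv_I (\<lambda>t. exp (stretch a b (polar_log c \<theta> t)))
      (\<lambda>t. exp (stretch a b (polar_log c \<theta> t)) * stretch a b (?w t))" .
  have "Ck n (\<lambda>t. stretch a b (?w t))" for n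
    unfolding divide_inverse using c(2) deriv_I_Cinf[OF c(2)] nz Cinf_iff_Ck
    by (intro Ck_bounded_linear[OF bounded_linear_stretch] Ck_mult Ck_inverse) auto
  then have "Ck n (\<lambda>t. of_real (2 * b) * exp (stretch a b (polar_log c \<theta> t)))" for n
    by (intro Ck_mult Ck_const Ck_linear_ode[OF E])
  then have "Ck n (F_arg a b c \<theta>)" for n
    using Ck_cong[of n _ "F_arg a b c \<theta>"] F_arg_eq_exp_stretch[OF nz] by metis
  moreover have "F_arg a b c \<theta> t \<noteq> 0" if "t \<in> {0..1}" for t
    unfolding F_arg_eq_exp_stretch[OF nz[OF that]] using assms(1) by simp
  ultimately show ?thesis by (simp add: Cinf_star_def Cinf_iff_Ck)
qed

lemma cmod_F_arg_squared:
  "(cmod (F_arg a b c \<theta> t))\<^sup>2 = 4 * b\<^sup>2 * cmod (deriv_I c t)"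
  by (simp add: F_arg_def norm_mult power_mult_distrib)

section \<open>Variations of an immersion\<close>

text \<open>
  The derivative of \<open>log c'\<close> in the direction \<open>h\<close>.
\<close>

definition log_velocity_variation :: "(real \<Rightarrow> complex) \<Rightarrow> (real \<Rightarrow> complex) \<Rightarrow> real \<Rightarrow> complex" where
  "log_velocity_variation c h t = deriv_I h t * inverse (deriv_I c t)"

lemma log_velocity_variation_Cinf:
  assumes "c \<in> Imm" "h \<in> Cinf"
  shows "log_velocity_variation c h \<in> Cinf"
  unfolding Cinf_iff_Ck log_velocity_variation_def
proof
  fix n
  have "Ck n (deriv_I c)" "Ck n (deriv_I h)" "\<And>t. t \<in> {0..1} \<Longrightarrow> deriv_I c t \<noteq> 0"
    using assms deriv_I_Cinf Cinf_iff_Ck by (auto simp: Imm_def)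
  then show "Ck n (\<lambda>t. deriv_I h t * inverse (deriv_I c t))"
    by (intro Ck_mult Ck_inverse) auto
qed

lemma deriv_I_line_through:
  assumes "c \<in> Imm" "h \<in> Cinf" "t \<in> {0..1}"
  shows "deriv_I (line_through c h \<epsilon>) t =
    deriv_I c t * (1 + of_real \<epsilon> * log_velocity_variation c h t)"
proof -
  have c: "c \<in> Cinf" "deriv_I c t \<noteq> 0" using assms by (auto simp: Imm_def)
  have "has_deriv_I (line_through c h \<epsilon>) (\<lambda>t. deriv_I c t + of_real \<epsilon> * deriv_I h t)"
    unfolding line_through_def
    using has_deriv_I_deriv_I[OF c(1)] has_deriv_I_deriv_I[OF assms(2)]
    by (auto intro!: has_vector_derivative_add has_vector_derivative_mult_right)
  from deriv_I_eqI[OF this assms(3)] show ?thesis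
    using c(2) by (simp add: log_velocity_variation_def field_simps)
qed

lemma line_through_Imm:
  assumes "c \<in> Imm" "h \<in> Cinf"
    and small: "\<And>t. t \<in> {0..1} \<Longrightarrow> cmod (of_real \<epsilon> * log_velocity_variation c h t) < 1"
  shows "line_through c h \<epsilon> \<in> Imm"
proof -
  have "Ck n (\<lambda>t. c t + of_real \<epsilon> * h t)" for n
    using assms(1,2) Cinf_iff_Ck by (intro Ck_add Ck_mult Ck_const) (auto simp: Imm_def)
  then have "line_through c h \<epsilon> \<in> Cinf"
    by (simp add: Cinf_iff_Ck line_through_def)
  moreover have "deriv_I (line_through c h \<epsilon>) t \<noteq> 0" if "t \<in> {0..1}" for t
    using assms(1) one_plus_small_notin_nonpos_Reals(2)[OF small[OF that]] that
    by (simp add: deriv_I_line_through[OF assms(1,2) that] Imm_def)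
  ultimately show ?thesis by (simp add: Imm_def)
qed

lemma near_arg_line_through:
  assumes "c \<in> Imm" "h \<in> Cinf" "continuous_arg c \<theta>"
    and small: "\<And>t. t \<in> {0..1} \<Longrightarrow> cmod (of_real \<epsilon> * log_velocity_variation c h t) < 1"
  shows "continuous_arg (line_through c h \<epsilon>) (near_arg \<theta> (line_through c h \<epsilon>))"
    and "\<forall>t\<in>{0..1}. \<bar>near_arg \<theta> (line_through c h \<epsilon>) t - \<theta> t\<bar> < pi"
proof -
  have "cmod (deriv_I (line_through c h \<epsilon>) t - deriv_I c t) < cmod (deriv_I c t)"
    if t: "t \<in> {0..1}" for t
  proof -
    have "deriv_I (line_through c h \<epsilon>) t - deriv_I c t =
        deriv_I c t * (of_real \<epsilon> * log_velocity_variation c h t)"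
      unfolding deriv_I_line_through[OF assms(1,2) t] by (simp add: algebra_simps)
    then show ?thesis using small[OF t] assms(1) t by (simp add: norm_mult Imm_def)
  qed
  note near = near_arg[OF assms(1) line_through_Imm[OF assms(1,2) small] assms(3) ballI[OF this]]
  show "continuous_arg (line_through c h \<epsilon>) (near_arg \<theta> (line_through c h \<epsilon>))"
    using near(1) by blast
  show "\<forall>t\<in>{0..1}. \<bar>near_arg \<theta> (line_through c h \<epsilon>) t - \<theta> t\<bar> < pi"
    using near(2) by blast
qed

text \<open>
  The two logarithms of velocities differ by a logarithm of \<open>1 + \<epsilon> u\<close> whose imaginary part lies
  strictly between \<open>- \<pi>\<close> and \<open>\<pi>\<close>, by the defining property of the nearby argument. It is thus the
  principal one, and the non-constructive choice in \<open>near_arg\<close> disappears.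
\<close>

lemma F_local_line_through:
  assumes "c \<in> Imm" "h \<in> Cinf" "continuous_arg c \<theta>"
    and small: "\<And>t. t \<in> {0..1} \<Longrightarrow> cmod (of_real \<epsilon> * log_velocity_variation c h t) < 1"
    and t: "t \<in> {0..1}"
  shows "F_local a b \<theta> (line_through c h \<epsilon>) t =
    F_arg a b c \<theta> t * exp (stretch a b (Ln (1 + of_real \<epsilon> * log_velocity_variation c h t)))"
proof -
  let ?l = "line_through c h \<epsilon>"
  let ?v = "1 + of_real \<epsilon> * log_velocity_variation c h t"
  let ?d = "polar_log ?l (near_arg \<theta> ?l) t - polar_log c \<theta> t"
  note near = near_arg_line_through[OF assms(1,2,3) small]
  have nz: "deriv_I c t \<noteq> 0" "deriv_I ?l t \<noteq> 0"
    using assms(1) t line_through_Imm[OF assms(1,2) small] by (auto simp: Imm_def)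
  have "exp ?d = ?v"
    using exp_polar_log[OF near(1) t nz(2)] exp_polar_log[OF assms(3) t nz(1)] nz
      deriv_I_line_through[OF assms(1,2) t, of \<epsilon>] by (simp add: exp_diff)
  moreover have "\<bar>Im ?d\<bar> < pi" using near(2) t by (simp add: polar_log_def)
  ultimately have "Ln ?v = ?d" by (intro Ln_unique) auto
  then have "polar_log ?l (near_arg \<theta> ?l) t = polar_log c \<theta> t + Ln ?v" by simp
  then show ?thesis
    using bounded_linear.linear[OF bounded_linear_stretch, THEN linear_add]
    by (simp add: F_local_def F_arg_eq_exp_stretch nz exp_add)
qed

lemma line_through_0: "line_through c h 0 = c"
  by (simp add: line_through_def)

text \<open>
  On the interval the difference quotient is \<open>F(c)\<close>, independent of \<open>\<epsilon>\<close>, times the difference quotient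
  of the exponential factor.
\<close>

lemma F_local_difference_quotient_tendsto:
  assumes "b > 0" "c \<in> Imm" "h \<in> Cinf" "continuous_arg c \<theta>"
  shows "uniform_limit {0..1}
    (\<lambda>\<epsilon>. (deriv_I ^^ n)
      (\<lambda>t. (F_local a b \<theta> (line_through c h \<epsilon>) t - F_local a b \<theta> (line_through c h 0) t) /\<^sub>R \<epsilon>))
    ((deriv_I ^^ n) (\<lambda>t. F_arg a b c \<theta> t * stretch a b (log_velocity_variation c h t))) (at 0)"
proof -
  let ?u = "log_velocity_variation c h" and ?Q = "F_arg a b c \<theta>"
  let ?D = "\<lambda>\<epsilon> t. (exp (stretch a b (Ln (1 + of_real \<epsilon> * ?u t))) - 1) /\<^sub>R \<epsilon>"
  let ?G = "\<lambda>\<epsilon> t. (F_local a b \<theta> (line_through c h \<epsilon>) t - F_local a b \<theta> (line_through c h 0) t) /\<^sub>R \<epsilon>"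
  have u: "?u \<in> Cinf" using assms(2,3) by (rule log_velocity_variation_Cinf)
  then have cont: "continuous_on {0..1} ?u" by (auto simp: Cinf_iff_Ck dest: spec[of _ 0])
  have "Ck n ?Q" using F_arg_Cinf_star[OF assms(1,2,4)] by (simp add: Cinf_star_def Cinf_iff_Ck)
  then have "Ck_tendsto n (at 0) (\<lambda>\<epsilon> t. ?Q t * ?D \<epsilon> t) (\<lambda>t. ?Q t * stretch a b (?u t))"
    using Ck_tendsto_difference_quotient[OF bounded_linear_stretch u]
    by (intro Ck_tendsto_mult Ck_tendsto_const)
  note lim = Ck_tendsto_funpow_deriv_I[OF this]
  have ev: "\<forall>\<^sub>F \<epsilon> in at 0. \<forall>t\<in>{0..1}. (deriv_I ^^ n) (\<lambda>t. ?Q t * ?D \<epsilon> t) t = (deriv_I ^^ n) (?G \<epsilon>) t"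
    using eventually_at_scaled_small[OF cont zero_less_one]
  proof eventually_elim
    case (elim \<epsilon>)
    have "?Q t * ?D \<epsilon> t = ?G \<epsilon> t" if t: "t \<in> {0..1}" for t
    proof -
      have "F_local a b \<theta> (line_through c h \<epsilon>) t - F_local a b \<theta> (line_through c h 0) t =
          ?Q t * (exp (stretch a b (Ln (1 + of_real \<epsilon> * ?u t))) - 1)"
        using F_local_line_through[OF assms(2,3,4) _ t, of \<epsilon> a b] elim
          F_local_eq_F_arg[OF assms(2,4) t, of a b] by (simp add: line_through_0 algebra_simps)
      then show ?thesis by simp
    qed
    then show ?case by (intro ballI funpow_deriv_I_cong)
  qed
  show ?thesis by (rule uniform_limit_cong[THEN iffD1, OF ev refl lim])
qed

lemma DF_F_local:
  assumes "b > 0" "c \<in> Imm" "h \<in> Cinf" "continuous_arg c \<theta>" "t \<in> {0..1}"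
  shows "DF (F_local a b \<theta>) c h t = F_arg a b c \<theta> t * stretch a b (log_velocity_variation c h t)"
proof -
  let ?f = "\<lambda>\<epsilon>. F_local a b \<theta> (line_through c h \<epsilon>) t"
  let ?W = "F_arg a b c \<theta> t * stretch a b (log_velocity_variation c h t)"
  have "((\<lambda>\<epsilon>. (?f \<epsilon> - ?f 0) /\<^sub>R \<epsilon>) \<longlongrightarrow> ?W) (at 0)"
    using tendsto_uniform_limitI[OF
        F_local_difference_quotient_tendsto[OF assms(1-4), of 0] assms(5)] by simp
  then have "((\<lambda>\<epsilon>. norm ((?f \<epsilon> - ?f 0) /\<^sub>R \<epsilon> - ?W)) \<longlongrightarrow> 0) (at 0)"
    by (intro tendsto_norm_zero LIM_zero)
  moreover have "norm ((?f \<epsilon> - ?f 0) /\<^sub>R \<epsilon> - ?W) = norm (?f (0 + \<epsilon>) - ?f 0 - \<epsilon> *\<^sub>R ?W) / norm \<epsilon>"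
    if "\<epsilon> \<noteq> 0" for \<epsilon> :: real
  proof -
    have "(?f \<epsilon> - ?f 0) /\<^sub>R \<epsilon> - ?W = (?f (0 + \<epsilon>) - ?f 0 - \<epsilon> *\<^sub>R ?W) /\<^sub>R \<epsilon>"
      using that by (simp add: scaleR_diff_right)
    then show ?thesis by (simp add: divide_inverse mult.commute)
  qed
  ultimately have "((\<lambda>\<epsilon>. norm (?f (0 + \<epsilon>) - ?f 0 - \<epsilon> *\<^sub>R ?W) / norm \<epsilon>) \<longlongrightarrow> 0) (at 0)"
    by (simp cong: LIM_cong)
  then have "(?f has_vector_derivative ?W) (at 0)"
    by (simp add: has_vector_derivative_def has_derivative_at bounded_linear_scaleR_left)
  then show ?thesis unfolding DF_def by (rule vector_derivative_at)
qed

lemma F_local_has_Cinf_derivative: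
  assumes "b > 0" "c \<in> Imm" "h \<in> Cinf" "continuous_arg c \<theta>"
  shows "has_Cinf_derivative (\<lambda>\<epsilon>. F_local a b \<theta> (line_through c h \<epsilon>)) (DF (F_local a b \<theta>) c h)"
  unfolding has_Cinf_derivative_def
proof (intro conjI allI)
  let ?u = "log_velocity_variation c h"
  let ?W = "\<lambda>t. F_arg a b c \<theta> t * stretch a b (?u t)"
  have u: "?u \<in> Cinf" using assms(2,3) by (rule log_velocity_variation_Cinf)
  then have cont: "continuous_on {0..1} ?u" by (auto simp: Cinf_iff_Ck dest: spec[of _ 0])
  show "\<forall>\<^sub>F \<epsilon> in nhds 0. F_local a b \<theta> (line_through c h \<epsilon>) \<in> Cinf"
    using eventually_scaled_small[OF cont zero_less_one]
  proof eventually_elim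
    case (elim \<epsilon>)
    have "F_arg a b (line_through c h \<epsilon>) (near_arg \<theta> (line_through c h \<epsilon>)) \<in> Cinf_star"
      using elim assms line_through_Imm near_arg_line_through(1) by (intro F_arg_Cinf_star) blast+
    then have "F_arg a b (line_through c h \<epsilon>) (near_arg \<theta> (line_through c h \<epsilon>)) \<in> Cinf"
      by (simp add: Cinf_star_def)
    moreover have "F_local a b \<theta> (line_through c h \<epsilon>) =
        F_arg a b (line_through c h \<epsilon>) (near_arg \<theta> (line_through c h \<epsilon>))"
      by (simp add: F_local_def fun_eq_iff)
    ultimately show ?case by simp
  qed
  have W: "?W t = DF (F_local a b \<theta>) c h t" if "t \<in> {0..1}" for t
    using DF_F_local[OF assms that] by simp
  have "Ck n ?W" for n
    using u F_arg_Cinf_star[OF assms(1,2,4)] Cinf_iff_Ck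
    by (intro Ck_mult Ck_bounded_linear[OF bounded_linear_stretch]) (auto simp: Cinf_star_def)
  then have "Ck n (DF (F_local a b \<theta>) c h)" for n by (rule Ck_cong) (rule W)
  then show "DF (F_local a b \<theta>) c h \<in> Cinf" by (simp add: Cinf_iff_Ck)
  fix n
  have eq: "(deriv_I ^^ n) ?W t = (deriv_I ^^ n) (DF (F_local a b \<theta>) c h) t" if "t \<in> {0..1}" for t
    using W that by (rule funpow_deriv_I_cong)
  show "uniform_limit {0..1} (\<lambda>\<epsilon>. (deriv_I ^^ n)
      (\<lambda>t. (F_local a b \<theta> (line_through c h \<epsilon>) t - F_local a b \<theta> (line_through c h 0) t) /\<^sub>R \<epsilon>))
      ((deriv_I ^^ n) (DF (F_local a b \<theta>) c h)) (at 0)"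
    by (rule uniform_limit_cong'[THEN iffD1, OF refl eq F_local_difference_quotient_tendsto[OF assms]])
qed

section \<open>Comparison of the metrics\<close>

text \<open>
  As \<open>D\<^sub>s h / T = h' / c'\<close> and \<open>|T| = 1\<close>, dividing by \<open>T\<close> rotates the moving frame \<open>(T, N)\<close> to
  \<open>(1, \<i>)\<close>.
\<close>

lemma elastic_integrand:
  assumes "deriv_I c t \<noteq> 0"
  shows "D_s c h t \<bullet> unit_tangent c t = Re (log_velocity_variation c h t)"
    and "D_s c h t \<bullet> unit_normal c t = Im (log_velocity_variation c h t)"
proof -
  let ?p = "deriv_I c t" and ?q = "deriv_I h t"
  have inv: "inverse ?p = cnj ?p /\<^sub>R (cmod ?p)\<^sup>2"
    using complex_div_cnj[of 1 ?p] by (simp add: scaleR_conv_of_real divide_inverse mult.commute)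
  show "D_s c h t \<bullet> unit_tangent c t = Re (log_velocity_variation c h t)"
    unfolding D_s_def unit_tangent_def log_velocity_variation_def inv
    by (simp add: inner_complex_def power2_eq_square field_simps add_divide_distrib diff_divide_distrib)
  show "D_s c h t \<bullet> unit_normal c t = Im (log_velocity_variation c h t)"
    unfolding D_s_def unit_normal_def unit_tangent_def log_velocity_variation_def inv
    by (simp add: inner_complex_def power2_eq_square field_simps add_divide_distrib diff_divide_distrib)
qed

lemma Re_stretch_mult_cnj:
  "Re (stretch a b z * cnj (stretch a b w)) = Re z * Re w / 4 + (a / (2 * b))\<^sup>2 * Im z * Im w"
  by (simp add: stretch_def power2_eq_square)

lemma g_L2_DF_F_local:
  assumes "b > 0" "c \<in> Imm" "h \<in> Cinf" "k \<in> Cinf" "continuous_arg c \<theta>"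
  shows "g_L2 q (DF (F_local a b \<theta>) c h) (DF (F_local a b \<theta>) c k) = g_elastic a b c h k"
proof -
  let ?w = "DF (F_local a b \<theta>) c h" and ?z = "DF (F_local a b \<theta>) c k"
  have "?w \<in> Cinf" "?z \<in> Cinf"
    using F_local_has_Cinf_derivative assms by (auto simp: has_Cinf_derivative_def)
  then have "continuous_on {0..1} ?w" "continuous_on {0..1} ?z"
    by (auto simp: Cinf_iff_Ck dest: spec[of _ 0])
  then have "(\<lambda>t. ?w t * cnj (?z t)) integrable_on {0..1}"
    by (intro integrable_continuous_interval continuous_intros)
  from integral_linear[OF this bounded_linear_Re]
  have "g_L2 q ?w ?z = integral {0..1} (\<lambda>t. Re (?w t * cnj (?z t)))"
    by (simp add: g_L2_def o_def)
  also have "\<dots> = g_elastic a b c h k"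
    unfolding g_elastic_def
  proof (rule integral_cong)
    fix t :: real assume t: "t \<in> {0..1}"
    then have nz: "deriv_I c t \<noteq> 0" using assms(2) by (simp add: Imm_def)
    let ?Q = "F_arg a b c \<theta> t"
    let ?S = "\<lambda>h. stretch a b (log_velocity_variation c h t)"
    have "?w t * cnj (?z t) = (?Q * cnj ?Q) * (?S h * cnj (?S k))"
      using DF_F_local t assms by (simp add: mult_ac)
    also have "?Q * cnj ?Q = of_real (4 * b\<^sup>2 * cmod (deriv_I c t))"
      unfolding cmod_F_arg_squared[of a b c \<theta> t, symmetric] by (rule complex_norm_square[symmetric])
    finally have integrand: "Re (?w t * cnj (?z t)) = 4 * b\<^sup>2 * cmod (deriv_I c t) * Re (?S h * cnj (?S k))"
      by (simp only: Re_complex_of_real Im_complex_of_real complex_mult_cnj times_complex.sel)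
    let ?u = "log_velocity_variation c h t" and ?v = "log_velocity_variation c k t"
    have "4 * b\<^sup>2 * cmod (deriv_I c t) * Re (?S h * cnj (?S k)) =
        (a\<^sup>2 * Im ?u * Im ?v + b\<^sup>2 * Re ?u * Re ?v) * cmod (deriv_I c t)"
      unfolding Re_stretch_mult_cnj using assms(1) by (simp add: field_simps power2_eq_square)
    then show "Re (?w t * cnj (?z t)) =
        (a\<^sup>2 * (D_s c h t \<bullet> unit_normal c t) * (D_s c k t \<bullet> unit_normal c t)
          + b\<^sup>2 * (D_s c h t \<bullet> unit_tangent c t) * (D_s c k t \<bullet> unit_tangent c t))
        * cmod (deriv_I c t)"
      unfolding elastic_integrand[OF nz] integrand .
  qed
  finally show ?thesis .
qed

theorem theorem2p3:
  fixes a b :: real and c h k :: "real \<Rightarrow> complex" and \<theta> :: "real \<Rightarrow> real"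
  assumes "a > 0" and "b > 0"
    and "c \<in> Imm_Tra"
    and "h \<in> tangent_Tra" and "k \<in> tangent_Tra"
    and "continuous_arg c \<theta>"
  shows "F_local a b \<theta> c \<in> Cinf_star
    \<and> has_Cinf_derivative (\<lambda>\<epsilon>. F_local a b \<theta> (line_through c h \<epsilon>)) (DF (F_local a b \<theta>) c h)
    \<and> has_Cinf_derivative (\<lambda>\<epsilon>. F_local a b \<theta> (line_through c k \<epsilon>)) (DF (F_local a b \<theta>) c k)
    \<and> g_L2 (F_local a b \<theta> c) (DF (F_local a b \<theta>) c h) (DF (F_local a b \<theta>) c k)
        = g_elastic a b c h k"
proof -
  have c: "c \<in> Imm" and h: "h \<in> Cinf" and k: "k \<in> Cinf"
    using assms by (auto simp: Imm_Tra_def tangent_Tra_def)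
  note arg = \<open>continuous_arg c \<theta>\<close> and b = \<open>b > 0\<close>
  have F: "F_arg a b c \<theta> \<in> Cinf_star" using b c arg by (rule F_arg_Cinf_star)
  have eq: "F_arg a b c \<theta> t = F_local a b \<theta> c t" if "t \<in> {0..1}" for t
    using F_local_eq_F_arg[OF c arg that] by simp
  have "Ck n (F_local a b \<theta> c)" for n
    using Ck_cong[of n "F_arg a b c \<theta>", OF _ eq] F by (simp add: Cinf_star_def Cinf_iff_Ck)
  then have "F_local a b \<theta> c \<in> Cinf_star"
    using F eq by (simp add: Cinf_star_def Cinf_iff_Ck)
  then show ?thesis
    using F_local_has_Cinf_derivative[OF b c h arg] F_local_has_Cinf_derivative[OF b c k arg]
      g_L2_DF_F_local[OF b c h k arg] by blast
qed

end
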